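(* Let $\lambda>0$ and let $\mathbf{s}_3=\{\tilde{\mathbf d}_3,\mathbf d_3,\mathbf h_3\}$ be a minimizer of (P3). If the set $\mathcal H(\tilde{\mathbf d}_3,\mathbf d_3)$ is non-empty, then $\mathbf h_3\in\mathcal H(\tilde{\mathbf d}_3,\mathbf d_3)$.
   Context: Network data. A water distribution system is a finite directed graph $\mathcal G=(\mathcal M,\mathcal P)$ without self-loops, such that $(m,n)\in\mathcal P$ implies $(n,m)\notin\mathcal P$; the edge directions are arbitrary reference directions, and $P=|\mathcal P|$. $\mathcal M_r\subset\mathcal M$ (reservoirs) and $\mathcal M_b\subset\mathcal M$ (tanks) are disjoint. $\mathcal P_a\subset\mathcal P$ is the set of edges that are (ideal, fixed-speed) pumps; $\bar{\mathcal P}_a=\mathcal P\setminus\mathcal P_a$ is the set of lossy pipes. Times are $t=1,\dots,T$. Given real data: injections $d_m^t\le 0$ for $m\notin\mathcal M_r\cup\mathcal M_b$ (consumer demands); minimum pressures $\underline h_m$ ($m\in\mathcal M$); loss coefficients $c_{mn}>0$ for $(m,n)\in\bar{\mathcal P}_a$; for pumps $(m,n)\in\mathcal P_a$: pressure gains $g_{mn}\ge 0$, flow limits $0<\underline d_{mn}\le\overline d_{mn}$, and electricity coefficients $c_{mn}$; reservoir pressures $\bar h_m$ ($m\in\mathcal M_r$); for tanks $m\in\mathcal M_b$: areas $A_m>0$, level limits $\underline\ell_m\le\overline\ell_m$, initial levels $\ell_m^0$; a period length $\delta>0$; prices $\pi_t$. Variables (for all $t$): pressures $h_m^t$ ($m\in\mathcal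 M$); injections $d_m^t$ ($m\in\mathcal M_r\cup\mathcal M_b$); flows $d_{mn}^t$ ($(m,n)\in\mathcal P$); pump flows $\tilde d_{mn}^t$ ($(m,n)\in\mathcal P_a$); tank variables $\tilde h_m^t,\ell_m^t$ ($m\in\mathcal M_b$); binaries $x_{mn}^t\in\{0,1\}$ ($(m,n)\in\mathcal P$), $\alpha_m^t\in\{0,1\}$ ($m\in\mathcal M_r\cup\mathcal M_b$), $\beta_m^t\in\{0,1\}$ ($m\in\mathcal M_b$). The vectors $\tilde{\mathbf d},\mathbf d,\mathbf h$ collect all pump flows $\tilde d_{mn}^t$, all flows $d_{mn}^t$ over $\mathcal P$, and all pressures $h_m^t$; superscript $t$ on a vector denotes its entries at time $t$. Constraints common to all problems (for all $t$), with on/off (big-$M$) constraints written in logical form: - conservation: $d_m^t=\sum_{k:(m,k)\in\mathcal P}d_{mk}^t-\sum_{k:(k,m)\in\mathcal P}d_{km}^t$ for all $m\in\mathcal M$; - minimum pressure: $h_m^t\ge\underline h_m$ for all $m$; - pumps $(m,n)\in\mathcal P_a$: $h_m^t-h_n^t=-g_{mn}x_{mn}^t$; $\underline d_{mn}x_{mn}^t\le\tilde d_{mn}^t\le\overline d_{mn}x_{mn}^t$; and if $x_{mn}^t=1$ then $d_{mn}^t=\tilde d_{mn}^t$; - reservoirs $m\in\mathcal M_r$: $d_m^t\ge0$; if $\alpha_m^t=0$ then $d_m^t=0$; if $\alpha_m^t=1$ then $h_m^t\le\bar h_m$; - tanks $m\in\mathcal M_b$: $\ell_m^t=\ell_m^{t-1}-d_m^t\delta/A_m$;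 $\underline\ell_m\le\ell_m^t\le\overline\ell_m$; $\ell_m^T=\ell_m^0$; if $\alpha_m^t=1$ then $\tilde h_m^t=h_m^t$; if $\alpha_m^t=0$ then $d_m^t=0$; if $\beta_m^t=1$ then $d_m^t\le0$ and $\tilde h_m^t\ge\overline\ell_m$; if $\beta_m^t=0$ then $d_m^t\ge0$ and $\tilde h_m^t\le\ell_m^t$. Relaxed pressure-drop constraints for lossy pipes $(m,n)\in\bar{\mathcal P}_a$: if $x_{mn}^t=1$ then $d_{mn}^t\ge0$ and $h_m^t-h_n^t\ge c_{mn}(d_{mn}^t)^2$; if $x_{mn}^t=0$ then $d_{mn}^t\le0$ and $h_n^t-h_m^t\ge c_{mn}(d_{mn}^t)^2$. Problem (P3): minimize $f(\tilde{\mathbf d})+\lambda g(\mathbf h)$ subject to the common constraints and the relaxed pressure-drop constraints, where $f(\tilde{\mathbf d})=\sum_{t=1}^T\sum_{(m,n)\in\mathcal P_a}c_{mn}\pi_t\tilde d_{mn}^t$ and $g(\mathbf h)=\sum_{t=1}^T\sum_{(m,n)\in\bar{\mathcal P}_a}|h_m^t-h_n^t|$. A minimizer is identified with its components $\{\tilde{\mathbf d},\mathbf d,\mathbf h\}$. Matrix $\mathbf A(\mathbf d^t)$: the $P\times|\mathcal M|$ matrix whose row for $(m,n)\in\mathcal P$ has entry $+1$ at $m$ and $-1$ at $n$ if $d_{mn}^t\ge0$, entry $-1$ at $m$ and $+1$ at $n$ if $d_{mn}^t<0$, and zeros elsewhere. Vector $\mathbf b(\tilde{\mathbf d}^t,\mathbf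 d^t)$: its entry for a lossy pipe $(m,n)$ is $c_{mn}(d_{mn}^t)^2$; its entry for a pump $(m,n)$ is $-g_{mn}\,\mathrm{sign}(\tilde d_{mn}^t)$, with $\mathrm{sign}(0)=0$. Set $\mathcal H(\tilde{\mathbf d},\mathbf d)$: all $\mathbf h$ such that for every $t$ (i) $\mathbf A(\mathbf d^t)\mathbf h^t=\mathbf b(\tilde{\mathbf d}^t,\mathbf d^t)$, and (ii) the pressure bounds hold: $h_m^t\ge\underline h_m$ for all $m$; $h_m^t\le\bar h_m$ for every $m\in\mathcal M_r$ with $d_m^t>0$; $h_m^t\ge\overline\ell_m$ for every $m\in\mathcal M_b$ with $d_m^t<0$; $h_m^t\le\ell_m^t$ for every $m\in\mathcal M_b$ with $d_m^t>0$; here $d_m^t,\ell_m^t$ are computed from $\mathbf d$ by flow conservation and the tank-level recursion. *)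

theory Defs
  imports Complex_Main "Graph_Theory.Pair_Digraph"
begin

text \<open>
  Time periods are \<open>1, \<dots>, T\<close>.  All quantities are total functions; only their values at
  \<open>t \<in> {1..T}\<close> and on the relevant nodes or edges matter (tank levels also at time 0).
  The coefficient of an edge is the loss coefficient for a lossy pipe and the electricity
  coefficient for a pump.
\<close>

record 'v water_network =
  graph :: "'v pair_pre_digraph"
  reservoirs :: "'v set"
  tanks :: "'v set"
  pumps :: "('v \<times> 'v) set"
  horizon :: nat
  demand :: "nat \<Rightarrow> 'v \<Rightarrow> real"
  min_press :: "'v \<Rightarrow> real"
  coef :: "'v \<times> 'v \<Rightarrow> real"
  gain :: "'v \<times> 'v \<Rightarrow> real"
  pflow_lo :: "'v \<times> 'v \<Rightarrow> real"
  pflow_hi :: "'v \<times> 'v \<Rightarrow> real"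
  res_press :: "'v \<Rightarrow> real"
  area :: "'v \<Rightarrow> real"
  level_lo :: "'v \<Rightarrow> real"
  level_hi :: "'v \<Rightarrow> real"
  init_level :: "'v \<Rightarrow> real"
  period :: real
  price :: "nat \<Rightarrow> real"

abbreviation nodes :: "'v water_network \<Rightarrow> 'v set" where
  "nodes W \<equiv> pverts (graph W)"

abbreviation edges :: "'v water_network \<Rightarrow> ('v \<times> 'v) set" where
  "edges W \<equiv> parcs (graph W)"

abbreviation lossy_pipes :: "'v water_network \<Rightarrow> ('v \<times> 'v) set" where
  "lossy_pipes W \<equiv> edges W - pumps W"

abbreviation times :: "'v water_network \<Rightarrow> nat set" where
  "times W \<equiv> {1..horizon W}"

definition water_system :: "'v water_network \<Rightarrow> bool" where
  "water_system W \<longleftrightarrow>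
     pair_digraph (graph W) \<and>
     (\<forall>m n. (m, n) \<in> edges W \<longrightarrow> (n, m) \<notin> edges W) \<and>
     reservoirs W \<subseteq> nodes W \<and> tanks W \<subseteq> nodes W \<and> reservoirs W \<inter> tanks W = {} \<and>
     pumps W \<subseteq> edges W \<and>
     (\<forall>t \<in> times W. \<forall>m \<in> nodes W - (reservoirs W \<union> tanks W). demand W t m \<le> 0) \<and>
     (\<forall>e \<in> lossy_pipes W. 0 < coef W e) \<and>
     (\<forall>e \<in> pumps W. 0 \<le> gain W e \<and> 0 < pflow_lo W e \<and> pflow_lo W e \<le> pflow_hi W e) \<and>
     (\<forall>m \<in> tanks W. 0 < area W m \<and> level_lo W m \<le> level_hi W m) \<and>
     0 < period W"

record 'v decision =
  press :: "nat \<Rightarrow> 'v \<Rightarrow> real"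
  inj_var :: "nat \<Rightarrow> 'v \<Rightarrow> real"
  flow :: "nat \<Rightarrow> 'v \<times> 'v \<Rightarrow> real"
  pump_flow :: "nat \<Rightarrow> 'v \<times> 'v \<Rightarrow> real"
  tank_press :: "nat \<Rightarrow> 'v \<Rightarrow> real"
  level :: "nat \<Rightarrow> 'v \<Rightarrow> real"
  x_bin :: "nat \<Rightarrow> 'v \<times> 'v \<Rightarrow> real"
  alpha_bin :: "nat \<Rightarrow> 'v \<Rightarrow> real"
  beta_bin :: "nat \<Rightarrow> 'v \<Rightarrow> real"

text \<open>Injections are variables at reservoirs and tanks, and given data at all other nodes.\<close>

definition injection :: "'v water_network \<Rightarrow> 'v decision \<Rightarrow> nat \<Rightarrow> 'v \<Rightarrow> real" where
  "injection W s t m =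
     (if m \<in> reservoirs W \<union> tanks W then inj_var s t m else demand W t m)"

definition net_outflow ::
  "'v water_network \<Rightarrow> (nat \<Rightarrow> 'v \<times> 'v \<Rightarrow> real) \<Rightarrow> nat \<Rightarrow> 'v \<Rightarrow> real" where
  "net_outflow W d t m =
     (\<Sum>k | (m, k) \<in> edges W. d t (m, k)) - (\<Sum>k | (k, m) \<in> edges W. d t (k, m))"

definition binary_constraints :: "'v water_network \<Rightarrow> 'v decision \<Rightarrow> bool" where
  "binary_constraints W s \<longleftrightarrow> (\<forall>t \<in> times W.
     (\<forall>e \<in> edges W. x_bin s t e \<in> {0, 1}) \<and>
     (\<forall>m \<in> reservoirs W \<union> tanks W. alpha_bin s t m \<in> {0, 1}) \<and>
     (\<forall>m \<in> tanks W. beta_bin s t m \<in> {0, 1}))"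

definition conservation :: "'v water_network \<Rightarrow> 'v decision \<Rightarrow> bool" where
  "conservation W s \<longleftrightarrow>
     (\<forall>t \<in> times W. \<forall>m \<in> nodes W. injection W s t m = net_outflow W (flow s) t m)"

definition minimum_pressure :: "'v water_network \<Rightarrow> 'v decision \<Rightarrow> bool" where
  "minimum_pressure W s \<longleftrightarrow> (\<forall>t \<in> times W. \<forall>m \<in> nodes W. min_press W m \<le> press s t m)"

definition pump_constraints :: "'v water_network \<Rightarrow> 'v decision \<Rightarrow> bool" where
  "pump_constraints W s \<longleftrightarrow> (\<forall>t \<in> times W. \<forall>(m, n) \<in> pumps W.
     press s t m - press s t n = - gain W (m, n) * x_bin s t (m, n) \<and>
     pflow_lo W (m, n) * x_bin s t (m, n) \<le> pump_flow s t (m, n) \<and>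
     pump_flow s t (m, n) \<le> pflow_hi W (m, n) * x_bin s t (m, n) \<and>
     (x_bin s t (m, n) = 1 \<longrightarrow> flow s t (m, n) = pump_flow s t (m, n)))"

definition reservoir_constraints :: "'v water_network \<Rightarrow> 'v decision \<Rightarrow> bool" where
  "reservoir_constraints W s \<longleftrightarrow> (\<forall>t \<in> times W. \<forall>m \<in> reservoirs W.
     0 \<le> injection W s t m \<and>
     (alpha_bin s t m = 0 \<longrightarrow> injection W s t m = 0) \<and>
     (alpha_bin s t m = 1 \<longrightarrow> press s t m \<le> res_press W m))"

definition tank_constraints :: "'v water_network \<Rightarrow> 'v decision \<Rightarrow> bool" where
  "tank_constraints W s \<longleftrightarrow>
     (\<forall>m \<in> tanks W. level s 0 m = init_level W m \<and> level s (horizon W) m = init_level W m) \<and>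
     (\<forall>t \<in> times W. \<forall>m \<in> tanks W.
       level s t m = level s (t - 1) m - injection W s t m * period W / area W m \<and>
       level_lo W m \<le> level s t m \<and> level s t m \<le> level_hi W m \<and>
       (alpha_bin s t m = 1 \<longrightarrow> tank_press s t m = press s t m) \<and>
       (alpha_bin s t m = 0 \<longrightarrow> injection W s t m = 0) \<and>
       (beta_bin s t m = 1 \<longrightarrow>
          injection W s t m \<le> 0 \<and> level_hi W m \<le> tank_press s t m) \<and>
       (beta_bin s t m = 0 \<longrightarrow>
          0 \<le> injection W s t m \<and> tank_press s t m \<le> level s t m))"

definition relaxed_pressure_drop :: "'v water_network \<Rightarrow> 'v decision \<Rightarrow> bool" where
  "relaxed_pressure_drop W s \<longleftrightarrow> (\<forall>t \<in> times W. \<forall>(m, n) \<in> lossy_pipes W.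
     (x_bin s t (m, n) = 1 \<longrightarrow>
        0 \<le> flow s t (m, n) \<and>
        press s t m - press s t n \<ge> coef W (m, n) * (flow s t (m, n))\<^sup>2) \<and>
     (x_bin s t (m, n) = 0 \<longrightarrow>
        flow s t (m, n) \<le> 0 \<and>
        press s t n - press s t m \<ge> coef W (m, n) * (flow s t (m, n))\<^sup>2))"

definition P3_feasible :: "'v water_network \<Rightarrow> 'v decision \<Rightarrow> bool" where
  "P3_feasible W s \<longleftrightarrow>
     binary_constraints W s \<and> conservation W s \<and> minimum_pressure W s \<and>
     pump_constraints W s \<and> reservoir_constraints W s \<and> tank_constraints W s \<and>
     relaxed_pressure_drop W s"

definition pump_cost :: "'v water_network \<Rightarrow> (nat \<Rightarrow> 'v \<times> 'v \<Rightarrow> real) \<Rightarrow> real" where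
  "pump_cost W dp = (\<Sum>t \<in> times W. \<Sum>e \<in> pumps W. coef W e * price W t * dp t e)"

definition press_penalty :: "'v water_network \<Rightarrow> (nat \<Rightarrow> 'v \<Rightarrow> real) \<Rightarrow> real" where
  "press_penalty W h = (\<Sum>t \<in> times W. \<Sum>(m, n) \<in> lossy_pipes W. \<bar>h t m - h t n\<bar>)"

definition P3_objective :: "'v water_network \<Rightarrow> real \<Rightarrow> 'v decision \<Rightarrow> real" where
  "P3_objective W lam s = pump_cost W (pump_flow s) + lam * press_penalty W (press s)"

definition P3_minimizer :: "'v water_network \<Rightarrow> real \<Rightarrow> 'v decision \<Rightarrow> bool" where
  "P3_minimizer W lam s \<longleftrightarrow> is_arg_min (P3_objective W lam) (P3_feasible W) s"

text \<open>
  Matrices and vectors are functions on the index sets themselves: the rows of \<open>A_mat\<close> are the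
  elements of \<open>edges W\<close>, its columns those of \<open>nodes W\<close>.  The arguments \<open>d\<close>, \<open>dp\<close> of
  \<open>A_mat\<close> and \<open>b_vec\<close> are the flows and pump flows at one fixed time.
\<close>

definition A_mat :: "('v \<times> 'v \<Rightarrow> real) \<Rightarrow> 'v \<times> 'v \<Rightarrow> 'v \<Rightarrow> real" where
  "A_mat d e k =
     (if k = fst e then (if d e \<ge> 0 then 1 else - 1)
      else if k = snd e then (if d e \<ge> 0 then - 1 else 1)
      else 0)"

definition b_vec ::
  "'v water_network \<Rightarrow> ('v \<times> 'v \<Rightarrow> real) \<Rightarrow> ('v \<times> 'v \<Rightarrow> real) \<Rightarrow> 'v \<times> 'v \<Rightarrow> real" where
  "b_vec W dp d e = (if e \<in> pumps W then - gain W e * sgn (dp e) else coef W e * (d e)\<^sup>2)"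

primrec tank_level ::
  "'v water_network \<Rightarrow> (nat \<Rightarrow> 'v \<times> 'v \<Rightarrow> real) \<Rightarrow> nat \<Rightarrow> 'v \<Rightarrow> real" where
  "tank_level W d 0 m = init_level W m"
| "tank_level W d (Suc t) m =
     tank_level W d t m - net_outflow W d (Suc t) m * period W / area W m"

definition H_set ::
  "'v water_network \<Rightarrow> (nat \<Rightarrow> 'v \<times> 'v \<Rightarrow> real) \<Rightarrow> (nat \<Rightarrow> 'v \<times> 'v \<Rightarrow> real) \<Rightarrow>
   (nat \<Rightarrow> 'v \<Rightarrow> real) set" where
  "H_set W dp d = {h. \<forall>t \<in> times W.
     (\<forall>e \<in> edges W. (\<Sum>k \<in> nodes W. A_mat (d t) e k * h t k) = b_vec W (dp t) (d t) e) \<and>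
     (\<forall>m \<in> nodes W. min_press W m \<le> h t m) \<and>
     (\<forall>m \<in> reservoirs W. net_outflow W d t m > 0 \<longrightarrow> h t m \<le> res_press W m) \<and>
     (\<forall>m \<in> tanks W. net_outflow W d t m < 0 \<longrightarrow> h t m \<ge> level_hi W m) \<and>
     (\<forall>m \<in> tanks W. net_outflow W d t m > 0 \<longrightarrow> h t m \<le> tank_level W d t m)}"

end

theory Submission
  imports Defs
begin

text \<open>
  The pump flows and flows of a minimizer \<open>s\<close> are kept fixed and only its pressures are varied.
  Each relaxed pressure-drop constraint says that the pressure falls in the direction of the flow
  by at least the friction loss \<open>c d\<^sup>2\<close>, so \<open>|h\<^sub>m - h\<^sub>n| \<ge> c d\<^sup>2\<close> on every lossy
  pipe, and the penalty \<open>g\<close> of a feasible point is at least the total friction loss of its flows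
  (\<open>drop_ge_friction_loss\<close>).  Every \<open>h\<close> in \<open>H_set\<close> attains this lower bound, since
  the row of a lossy pipe is precisely the exact pressure-drop law (\<open>H_set_drop\<close>).

  Such an \<open>h\<close> can moreover be put into \<open>s\<close> without losing feasibility
  (\<open>feasible_with_H_set_pressures\<close>): the on/off variables of reservoirs and tanks can be chosen
  again to match the injections, and the bounds in \<open>H_set\<close> are what these choices demand.  The
  pumping cost is the same, so by optimality and \<open>\<lambda> > 0\<close> the penalty of \<open>s\<close> does not exceed the
  total friction loss either.  As a sum of terms bounded below by the friction losses, it
  can only do so if every relaxed constraint of \<open>s\<close> is tight, and tightness on all lossy pipes is
  the one thing that separates a feasible point from \<open>H_set\<close> (\<open>tight_in_H_set\<close>).
\<close>

section \<open>The energy equations, edge by edge\<close>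

lemma water_system_edge:
  assumes "water_system W" and "(m, n) \<in> edges W"
  shows "m \<in> nodes W" "n \<in> nodes W" "m \<noteq> n"
proof -
  interpret pair_digraph "graph W"
    using assms(1) by (simp add: water_system_def)
  show "m \<in> nodes W" "n \<in> nodes W" "m \<noteq> n"
    using assms(2) in_arcsD1[of m n] in_arcsD2[of m n] no_loops'[of m] by auto
qed

lemma water_system_finite:
  assumes "water_system W"
  shows "finite (nodes W)" "finite (edges W)"
proof -
  interpret pair_digraph "graph W"
    using assms by (simp add: water_system_def)
  show "finite (nodes W)" "finite (edges W)"
    by (rule pair_finite_verts, rule pair_finite_arcs)
qed

lemma A_mat_row:
  assumes W: "water_system W" and e: "(m, n) \<in> edges W"
  shows "(\<Sum>k \<in> nodes W. A_mat d (m, n) k * h k) =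
    (if d (m, n) \<ge> 0 then h m - h n else h n - h m)"
proof -
  note mn = water_system_edge[OF W e] and fin = water_system_finite(1)[OF W]
  have "(\<Sum>k \<in> nodes W. A_mat d (m, n) k * h k) = (\<Sum>k \<in> {m, n}. A_mat d (m, n) k * h k)"
    using mn fin by (intro sum.mono_neutral_right) (auto simp: A_mat_def)
  also have "\<dots> = (if d (m, n) \<ge> 0 then h m - h n else h n - h m)"
    using mn by (simp add: A_mat_def)
  finally show ?thesis .
qed

text \<open>
  An active pump has strictly positive flow, so its row of \<open>A\<close> is oriented along the edge; for an
  idle pump the flow may have either sign, but then the right-hand side vanishes and the
  orientation is irrelevant.
\<close>

lemma pump_row_iff:
  assumes W: "water_system W" and s: "P3_feasible W s"
    and t: "t \<in> times W" and e: "(m, n) \<in> pumps W"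
  shows "(\<Sum>k \<in> nodes W. A_mat (flow s t) (m, n) k * h k) =
      b_vec W (pump_flow s t) (flow s t) (m, n) \<longleftrightarrow>
    h m - h n = - gain W (m, n) * x_bin s t (m, n)"
proof -
  have E: "(m, n) \<in> edges W" and lo: "0 < pflow_lo W (m, n)"
    using W e by (auto simp: water_system_def)
  have "x_bin s t (m, n) = 0 \<or> x_bin s t (m, n) = 1"
    using s t E by (auto simp: P3_feasible_def binary_constraints_def)
  moreover have "pflow_lo W (m, n) * x_bin s t (m, n) \<le> pump_flow s t (m, n)"
    "pump_flow s t (m, n) \<le> pflow_hi W (m, n) * x_bin s t (m, n)"
    "x_bin s t (m, n) = 1 \<longrightarrow> flow s t (m, n) = pump_flow s t (m, n)"
    using s t e by (auto simp: P3_feasible_def pump_constraints_def)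
  ultimately consider
      "x_bin s t (m, n) = 0" "pump_flow s t (m, n) = 0"
    | "x_bin s t (m, n) = 1" "pump_flow s t (m, n) > 0" "flow s t (m, n) > 0"
    using lo by fastforce
  then show ?thesis
    by cases (use e in \<open>auto simp: A_mat_row[OF W E] b_vec_def\<close>)
qed

lemma pipe_row_iff:
  assumes W: "water_system W" and e: "(m, n) \<in> lossy_pipes W"
  shows "(\<Sum>k \<in> nodes W. A_mat d (m, n) k * h k) = b_vec W dp d (m, n) \<longleftrightarrow>
    (if d (m, n) \<ge> 0 then h m - h n else h n - h m) = coef W (m, n) * (d (m, n))\<^sup>2"
  using e A_mat_row[OF W, of m n d h] by (simp add: b_vec_def)

lemma friction_loss_nonneg:
  assumes "water_system W" and "e \<in> lossy_pipes W"
  shows "0 \<le> coef W e * r\<^sup>2"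
  using assms by (auto simp: water_system_def less_imp_le)

lemma drop_ge_friction_loss:
  assumes s: "P3_feasible W s" and t: "t \<in> times W" and e: "(m, n) \<in> lossy_pipes W"
  shows "coef W (m, n) * (flow s t (m, n))\<^sup>2 \<le> \<bar>press s t m - press s t n\<bar>"
proof -
  have "x_bin s t (m, n) = 0 \<or> x_bin s t (m, n) = 1"
    using s t e by (auto simp: P3_feasible_def binary_constraints_def)
  then show ?thesis
    using s t e by (fastforce simp: P3_feasible_def relaxed_pressure_drop_def)
qed

text \<open>
  The absolute value forgets the direction of the drop; the relaxed constraint recovers it, because
  it forces the drop to point along the flow.  For zero flow the loss is zero and the direction
  does not matter.
\<close>

lemma tight_drop_row:
  assumes W: "water_system W" and s: "P3_feasible W s"
    and t: "t \<in> times W" and e: "(m, n) \<in> lossy_pipes W"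
    and tight: "\<bar>press s t m - press s t n\<bar> = coef W (m, n) * (flow s t (m, n))\<^sup>2"
  shows "(\<Sum>k \<in> nodes W. A_mat (flow s t) (m, n) k * press s t k) =
    b_vec W (pump_flow s t) (flow s t) (m, n)"
proof -
  have x: "x_bin s t (m, n) = 0 \<or> x_bin s t (m, n) = 1"
    using s t e by (auto simp: P3_feasible_def binary_constraints_def)
  have r: "(x_bin s t (m, n) = 1 \<longrightarrow> 0 \<le> flow s t (m, n) \<and>
       press s t m - press s t n \<ge> coef W (m, n) * (flow s t (m, n))\<^sup>2) \<and>
     (x_bin s t (m, n) = 0 \<longrightarrow> flow s t (m, n) \<le> 0 \<and>
       press s t n - press s t m \<ge> coef W (m, n) * (flow s t (m, n))\<^sup>2)"
    using s t e unfolding P3_feasible_def relaxed_pressure_drop_def by fast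
  have nn: "0 \<le> coef W (m, n) * (flow s t (m, n))\<^sup>2"
    by (rule friction_loss_nonneg[OF W e])
  show ?thesis
  proof (cases "flow s t (m, n) = 0")
    case True
    then show ?thesis
      using tight by (subst pipe_row_iff[OF W e]) simp
  next
    case False
    then show ?thesis
      using tight x r nn by (subst pipe_row_iff[OF W e]) auto
  qed
qed

section \<open>Feasible points and the set of exact pressures\<close>

lemma level_eq_tank_level:
  assumes s: "P3_feasible W s" and W: "water_system W" and m: "m \<in> tanks W"
    and "t \<le> horizon W"
  shows "level s t m = tank_level W (flow s) t m"
  using \<open>t \<le> horizon W\<close>
proof (induction t)
  case 0
  then show ?case
    using s m by (simp add: P3_feasible_def tank_constraints_def)
next
  case (Suc t)
  have T: "Suc t \<in> times W" and "m \<in> nodes W"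
    using Suc.prems W m by (auto simp: water_system_def)
  then have "level s (Suc t) m = level s t m - injection W s (Suc t) m * period W / area W m"
    and "injection W s (Suc t) m = net_outflow W (flow s) (Suc t) m"
    using s m unfolding P3_feasible_def tank_constraints_def conservation_def by fastforce+
  then show ?case
    using Suc by simp
qed

text \<open>
  A nonzero injection switches on the pressure constraints of its node: \<open>\<alpha> = 0\<close> would
  force the injection to vanish, and the sign of the injection determines \<open>\<beta>\<close>.  Hence the bounds
  in \<open>H_set\<close> hold at every feasible point; the pump rows hold as well, which leaves the lossy pipes.
\<close>

lemma tight_in_H_set:
  assumes W: "water_system W" and s: "P3_feasible W s"
    and tight: "\<And>t m n. t \<in> times W \<Longrightarrow> (m, n) \<in> lossy_pipes W \<Longrightarrow>
      \<bar>press s t m - press s t n\<bar> = coef W (m, n) * (flow s t (m, n))\<^sup>2"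
  shows "press s \<in> H_set W (pump_flow s) (flow s)"
  unfolding H_set_def
proof (intro CollectI ballI conjI impI)
  fix t assume t: "t \<in> times W"
  have inj: "injection W s t m = net_outflow W (flow s) t m" if "m \<in> nodes W" for m
    using s t that by (simp add: P3_feasible_def conservation_def)
  show "(\<Sum>k \<in> nodes W. A_mat (flow s t) e k * press s t k) =
      b_vec W (pump_flow s t) (flow s t) e" if "e \<in> edges W" for e
  proof -
    obtain m n where e: "e = (m, n)" by (cases e)
    show ?thesis
    proof (cases "e \<in> pumps W")
      case True
      then have "press s t m - press s t n = - gain W (m, n) * x_bin s t (m, n)"
        using s t unfolding e P3_feasible_def pump_constraints_def by fast
      then show ?thesis
        using True pump_row_iff[OF W s t] unfolding e by blast
    next
      case False
      then show ?thesis
        using tight_drop_row[OF W s t] tight[OF t] that unfolding e by blast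
    qed
  qed
  show "min_press W m \<le> press s t m" if "m \<in> nodes W" for m
    using s t that by (simp add: P3_feasible_def minimum_pressure_def)
  show "press s t m \<le> res_press W m"
    if "m \<in> reservoirs W" and "net_outflow W (flow s) t m > 0" for m
  proof -
    have "injection W s t m > 0"
      using that inj W by (auto simp: water_system_def)
    moreover have "alpha_bin s t m = 0 \<or> alpha_bin s t m = 1"
      using s t that by (auto simp: P3_feasible_def binary_constraints_def)
    ultimately show ?thesis
      using s t that by (auto simp: P3_feasible_def reservoir_constraints_def)
  qed
  have tank: "(i < 0 \<longrightarrow> level_hi W m \<le> press s t m) \<and> (i > 0 \<longrightarrow> press s t m \<le> level s t m)"
    if m: "m \<in> tanks W" and i: "i = net_outflow W (flow s) t m" for m i
  proof -
    have "injection W s t m = i"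
      using m i inj W by (auto simp: water_system_def)
    moreover have "alpha_bin s t m = 0 \<or> alpha_bin s t m = 1"
      and "beta_bin s t m = 0 \<or> beta_bin s t m = 1"
      using s t m by (auto simp: P3_feasible_def binary_constraints_def)
    moreover have "(alpha_bin s t m = 1 \<longrightarrow> tank_press s t m = press s t m) \<and>
        (alpha_bin s t m = 0 \<longrightarrow> injection W s t m = 0) \<and>
        (beta_bin s t m = 1 \<longrightarrow> injection W s t m \<le> 0 \<and> level_hi W m \<le> tank_press s t m) \<and>
        (beta_bin s t m = 0 \<longrightarrow> 0 \<le> injection W s t m \<and> tank_press s t m \<le> level s t m)"
      using s t m unfolding P3_feasible_def tank_constraints_def by blast
    ultimately show ?thesis by auto
  qed
  show "level_hi W m \<le> press s t m"
    if "m \<in> tanks W" and "net_outflow W (flow s) t m < 0" for m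
    using tank that by blast
  show "press s t m \<le> tank_level W (flow s) t m"
    if "m \<in> tanks W" and "net_outflow W (flow s) t m > 0" for m
    using tank[OF _ refl, of m] that t level_eq_tank_level[OF s W, of m t] by simp
qed

lemma H_set_drop:
  assumes W: "water_system W" and h: "h \<in> H_set W dp d"
    and t: "t \<in> times W" and e: "(m, n) \<in> lossy_pipes W"
  shows "(if d t (m, n) \<ge> 0 then h t m - h t n else h t n - h t m) =
    coef W (m, n) * (d t (m, n))\<^sup>2"
proof -
  have "(\<Sum>k \<in> nodes W. A_mat (d t) (m, n) k * h t k) = b_vec W (dp t) (d t) (m, n)"
    using h t e unfolding H_set_def by blast
  then show ?thesis
    using pipe_row_iff[OF W e] by blast
qed

text \<open>
  At a reservoir or tank with zero injection, \<open>\<alpha> = 0\<close> frees the node pressure from the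
  reservoir pressure or from the tank variable.  The tank variable must still obey one of the two
  branches of \<open>\<beta>\<close>; the current level is a value that satisfies the branch \<open>\<beta> = 0\<close>.
\<close>

definition replace_pressures ::
  "'v water_network \<Rightarrow> (nat \<Rightarrow> 'v \<Rightarrow> real) \<Rightarrow> 'v decision \<Rightarrow> 'v decision" where
  "replace_pressures W h s = s\<lparr>
     press := h,
     tank_press := (\<lambda>t m. if injection W s t m = 0 then level s t m else h t m),
     alpha_bin := (\<lambda>t m. if injection W s t m = 0 then 0 else 1),
     beta_bin := (\<lambda>t m. if injection W s t m < 0 then 1 else 0)\<rparr>"

lemma replace_pressures_simps [simp]:
  "press (replace_pressures W h s) = h"
  "flow (replace_pressures W h s) = flow s"
  "pump_flow (replace_pressures W h s) = pump_flow s"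
  "level (replace_pressures W h s) = level s"
  "x_bin (replace_pressures W h s) = x_bin s"
  "tank_press (replace_pressures W h s) t m =
    (if injection W s t m = 0 then level s t m else h t m)"
  "alpha_bin (replace_pressures W h s) t m = (if injection W s t m = 0 then 0 else 1)"
  "beta_bin (replace_pressures W h s) t m = (if injection W s t m < 0 then 1 else 0)"
  "injection W (replace_pressures W h s) = injection W s"
  by (simp_all add: replace_pressures_def injection_def fun_eq_iff)

lemma feasible_with_H_set_pressures:
  assumes W: "water_system W" and s: "P3_feasible W s"
    and h: "h \<in> H_set W (pump_flow s) (flow s)"
  shows "P3_feasible W (replace_pressures W h s)" (is "P3_feasible W ?s")
proof -
  have inj: "injection W s t m = net_outflow W (flow s) t m"
    if "t \<in> times W" "m \<in> nodes W" for t m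
    using s that by (simp add: P3_feasible_def conservation_def)
  have sub: "reservoirs W \<subseteq> nodes W" "tanks W \<subseteq> nodes W" "pumps W \<subseteq> edges W"
    using W by (auto simp: water_system_def)
  have "binary_constraints W ?s"
    using s by (simp add: P3_feasible_def binary_constraints_def)
  moreover have "conservation W ?s"
    using s by (simp add: P3_feasible_def conservation_def)
  moreover have "minimum_pressure W ?s"
    using h by (auto simp: minimum_pressure_def H_set_def)
  moreover have "pump_constraints W ?s"
  proof -
    have "h t m - h t n = - gain W (m, n) * x_bin s t (m, n)"
      if "t \<in> times W" "(m, n) \<in> pumps W" for t m n
    proof -
      have "(\<Sum>k \<in> nodes W. A_mat (flow s t) (m, n) k * h t k) =
          b_vec W (pump_flow s t) (flow s t) (m, n)"
        using h that sub unfolding H_set_def by blast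
      then show ?thesis
        using pump_row_iff[OF W s that] by blast
    qed
    then show ?thesis
      using s by (fastforce simp: P3_feasible_def pump_constraints_def)
  qed
  moreover have "reservoir_constraints W ?s"
  proof -
    have "0 \<le> injection W s t m \<and> (injection W s t m \<noteq> 0 \<longrightarrow> h t m \<le> res_press W m)"
      if "t \<in> times W" "m \<in> reservoirs W" for t m
    proof
      show "0 \<le> injection W s t m"
        using s that by (simp add: P3_feasible_def reservoir_constraints_def)
      then show "injection W s t m \<noteq> 0 \<longrightarrow> h t m \<le> res_press W m"
        using h that sub inj[of t m] by (auto simp: H_set_def)
    qed
    then show ?thesis
      by (simp add: reservoir_constraints_def)
  qed
  moreover have "tank_constraints W ?s"
  proof -
    have bounds: "(injection W s t m < 0 \<longrightarrow> level_hi W m \<le> h t m) \<and>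
        (injection W s t m > 0 \<longrightarrow> h t m \<le> level s t m)"
      if "t \<in> times W" "m \<in> tanks W" for t m
      using h that sub inj[of t m] level_eq_tank_level[OF s W, of m t]
      by (auto simp: H_set_def)
    have tank: "tank_constraints W s"
      using s by (simp add: P3_feasible_def)
    show ?thesis
      unfolding tank_constraints_def replace_pressures_simps
    proof (intro conjI ballI)
      fix t m assume tm: "t \<in> times W" "m \<in> tanks W"
      note b = bounds[OF tm]
      show "(if injection W s t m < 0 then 1 else 0) = (1::real) \<longrightarrow>
          injection W s t m \<le> 0 \<and>
          level_hi W m \<le> (if injection W s t m = 0 then level s t m else h t m)"
        using b by simp
      show "(if injection W s t m < 0 then 1 else 0) = (0::real) \<longrightarrow>
          0 \<le> injection W s t m \<and>
          (if injection W s t m = 0 then level s t m else h t m) \<le> level s t m"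
        using b by simp
      show "(if injection W s t m = 0 then 0 else 1) = (1::real) \<longrightarrow>
          (if injection W s t m = 0 then level s t m else h t m) = h t m"
        "(if injection W s t m = 0 then 0 else 1) = (0::real) \<longrightarrow> injection W s t m = 0"
        by simp_all
    qed (use tank[unfolded tank_constraints_def] in blast)+
  qed
  moreover have "relaxed_pressure_drop W ?s"
  proof -
    have "(x_bin s t (m, n) = 1 \<longrightarrow> 0 \<le> flow s t (m, n) \<and>
           h t m - h t n \<ge> coef W (m, n) * (flow s t (m, n))\<^sup>2) \<and>
         (x_bin s t (m, n) = 0 \<longrightarrow> flow s t (m, n) \<le> 0 \<and>
           h t n - h t m \<ge> coef W (m, n) * (flow s t (m, n))\<^sup>2)"
      if t: "t \<in> times W" and e: "(m, n) \<in> lossy_pipes W" for t m n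
    proof -
      have "(x_bin s t (m, n) = 1 \<longrightarrow> 0 \<le> flow s t (m, n)) \<and>
          (x_bin s t (m, n) = 0 \<longrightarrow> flow s t (m, n) \<le> 0)"
        using s t e unfolding P3_feasible_def relaxed_pressure_drop_def by fast
      then show ?thesis
        using H_set_drop[OF W h t e] by (cases "flow s t (m, n) = 0") (auto split: if_splits)
    qed
    then show ?thesis
      unfolding relaxed_pressure_drop_def by auto
  qed
  ultimately show ?thesis
    by (simp add: P3_feasible_def)
qed

section \<open>Optimality makes every pressure drop tight\<close>

theorem theorem1:
  fixes W :: "'v water_network" and lam :: real and s3 :: "'v decision"
  assumes "water_system W"
    and "lam > 0"
    and "P3_minimizer W lam s3"
    and "H_set W (pump_flow s3) (flow s3) \<noteq> {}"
  shows "press s3 \<in> H_set W (pump_flow s3) (flow s3)"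
proof -
  note W = assms(1)
  obtain h where h: "h \<in> H_set W (pump_flow s3) (flow s3)"
    using assms(4) by blast
  have s: "P3_feasible W s3"
    and opt: "\<And>s. P3_feasible W s \<Longrightarrow> P3_objective W lam s3 \<le> P3_objective W lam s"
    using assms(3) by (auto simp: P3_minimizer_def is_arg_min_def not_less)
  let ?I = "times W \<times> lossy_pipes W"
  let ?drop = "\<lambda>p (t, m, n). \<bar>p t m - p t n :: real\<bar>"
  let ?loss = "\<lambda>(t, m, n). coef W (m, n) * (flow s3 t (m, n))\<^sup>2"
  have penalty: "press_penalty W p = sum (?drop p) ?I" for p
    by (simp add: press_penalty_def sum.cartesian_product)
  have "P3_objective W lam s3 \<le> P3_objective W lam (replace_pressures W h s3)"
    by (intro opt feasible_with_H_set_pressures W s h)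
  then have "press_penalty W (press s3) \<le> press_penalty W h"
    using assms(2) by (simp add: P3_objective_def)
  moreover have "sum (?drop h) ?I = sum ?loss ?I"
  proof (rule sum.cong[OF refl], clarify)
    fix t m n assume "t \<in> times W" and e: "(m, n) \<in> edges W" "(m, n) \<notin> pumps W"
    then show "\<bar>h t m - h t n\<bar> = coef W (m, n) * (flow s3 t (m, n))\<^sup>2"
      using H_set_drop[OF W h, of t m n] friction_loss_nonneg[OF W, of "(m, n)" "flow s3 t (m, n)"]
      by (auto split: if_splits)
  qed
  ultimately have le: "sum (?drop (press s3)) ?I \<le> sum ?loss ?I"
    by (simp add: penalty)
  have ge: "?loss i \<le> ?drop (press s3) i" if "i \<in> ?I" for i
    using drop_ge_friction_loss[OF s] that by auto
  have fin: "finite ?I"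
    using water_system_finite(2)[OF W] by simp
  have "sum ?loss ?I = sum (?drop (press s3)) ?I"
    using le sum_mono[of ?I ?loss, OF ge] by simp
  then have eq: "?loss i = ?drop (press s3) i" if "i \<in> ?I" for i
    using sum_mono_inv[of ?loss ?I "?drop (press s3)", OF _ ge that fin] by blast
  show ?thesis
  proof (rule tight_in_H_set[OF W s])
    fix t m n assume "t \<in> times W" "(m, n) \<in> lossy_pipes W"
    then show "\<bar>press s3 t m - press s3 t n\<bar> = coef W (m, n) * (flow s3 t (m, n))\<^sup>2"
      using eq[of "(t, m, n)"] by simp
  qed
qed

end
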